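(* Consider the $k$-means++ seeding algorithm on a finite set $\mathbf{X}\subset\mathbb{R}^d$ with a fixed optimal $k$-clustering $P_1,\dots,P_k$. Then for every $t\ge1$, $$\mathbb{E}\big[\widetilde{H}_{t+1}(\mathbf{X})\mid C_t\big]\le\widetilde{H}_t(\mathbf{X}).$$ In particular $\mathbb{E}[\mathrm{cost}(P_i,C_t)\mathbf{1}\{P_i\cap C_t\ne\varnothing\}]$ summed over $i$ is at most $5\,\mathrm{OPT}_k(\mathbf{X})$ for every $t$.
   Context: For a finite set $C\subset\mathbb{R}^d$ and a point $x$, $\mathrm{cost}(x,C)=\min_{c\in C}\|x-c\|^2$; $\mathrm{cost}(\mathbf{Y},C)=\sum_{x\in\mathbf{Y}}\mathrm{cost}(x,C)$; $\mathrm{OPT}_i(\mathbf{Y})=\min_{|C|=i}\mathrm{cost}(\mathbf{Y},C)$. The $k$-means++ seeding algorithm: $c_1$ uniform from $\mathbf{X}$, $C_1=\{c_1\}$; $C_{t+1}=C_t\cup\{x\}$ with $x$ chosen with probability $\mathrm{cost}(x,C_t)/\mathrm{cost}(\mathbf{X},C_t)$. Fix an optimal $k$-means clustering $P_1,\dots,P_k$ of $\mathbf{X}$ (a partition induced by an optimal center set, so $\mathrm{OPT}_k(\mathbf{X})=\sum_i\mathrm{OPT}_1(P_i)$). $P_i$ is covered by $C$ if $C\cap P_i\neq\varnothing$. Define $\widetilde H_t(P_i)=\mathrm{cost}(P_i,C_{t_i})$ if $P_i$ is covered by $C_t$, where $t_i\le t$ is the first time $P_i$ is covered, and $\widetilde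 H_t(P_i)=5\,\mathrm{OPT}_1(P_i)$ otherwise; $\widetilde H_t(\mathbf{X})=\sum_{i=1}^k\widetilde H_t(P_i)$. *)

theory Defs
  imports "HOL-Analysis.Analysis" "HOL-Probability.Probability"
begin

definition cost :: "'a::euclidean_space \<Rightarrow> 'a set \<Rightarrow> real" where
  "cost x C = (MIN c\<in>C. (norm (x - c))\<^sup>2)"

definition cost_set :: "'a::euclidean_space set \<Rightarrow> 'a set \<Rightarrow> real" where
  "cost_set Y C = (\<Sum>x\<in>Y. cost x C)"

definition OPT :: "nat \<Rightarrow> 'a::euclidean_space set \<Rightarrow> real" where
  "OPT i Y = (INF C \<in> {C. finite C \<and> card C = i}. cost_set Y C)"

text \<open>P 0, ..., P (k-1) is an optimal k-means clustering of X: a partition of X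
  induced by an optimal center set (each point of P i has center c i as a nearest center).\<close>
definition opt_clustering :: "'a::euclidean_space set \<Rightarrow> nat \<Rightarrow> (nat \<Rightarrow> 'a set) \<Rightarrow> bool" where
  "opt_clustering X k P \<longleftrightarrow>
     (\<forall>i<k. \<forall>j<k. i \<noteq> j \<longrightarrow> P i \<inter> P j = {}) \<and>
     (\<Union>i<k. P i) = X \<and>
     (\<exists>c. inj_on c {..<k} \<and> cost_set X (c ` {..<k}) = OPT k X \<and>
          (\<forall>i<k. \<forall>x\<in>P i. (norm (x - c i))\<^sup>2 = cost x (c ` {..<k})))"

text \<open>D^2 sampling: x chosen with probability cost(x,C)/cost(X,C).
  Convention for the degenerate case cost(X,C) = 0 (where D^2 sampling is undefined):
  choose uniformly from X.\<close>
definition d2_sample :: "'a::euclidean_space set \<Rightarrow> 'a set \<Rightarrow> 'a pmf" where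
  "d2_sample X C =
     (if cost_set X C = 0 then pmf_of_set X
      else embed_pmf (\<lambda>x. if x \<in> X then cost x C / cost_set X C else 0))"

text \<open>One k-means++ step on a history h = [c_1,...,c_t] (C_t = set h).\<close>
definition kmpp_step :: "'a::euclidean_space set \<Rightarrow> 'a list \<Rightarrow> 'a list pmf" where
  "kmpp_step X h = map_pmf (\<lambda>x. h @ [x]) (d2_sample X (set h))"

fun kmpp :: "'a::euclidean_space set \<Rightarrow> nat \<Rightarrow> 'a list pmf" where
  "kmpp X 0 = return_pmf []"
| "kmpp X (Suc 0) = map_pmf (\<lambda>c. [c]) (pmf_of_set X)"
| "kmpp X (Suc (Suc n)) = bind_pmf (kmpp X (Suc n)) (kmpp_step X)"

text \<open>Htilde_t(A) for the history h (t = length h): the cost of A w.r.t. C_{t_A},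
  where t_A is the first time A is covered, or 5 OPT_1(A) if A is not covered.\<close>
definition Htilde_cluster :: "'a::euclidean_space list \<Rightarrow> 'a set \<Rightarrow> real" where
  "Htilde_cluster h A =
     (if A \<inter> set h \<noteq> {}
      then cost_set A (set (take (LEAST j. A \<inter> set (take j h) \<noteq> {}) h))
      else 5 * OPT 1 A)"

definition Htilde :: "nat \<Rightarrow> (nat \<Rightarrow> 'a::euclidean_space set) \<Rightarrow> 'a list \<Rightarrow> real" where
  "Htilde k P h = (\<Sum>i<k. Htilde_cluster h (P i))"

end

theory Submission
  imports Defs
begin

text \<open>
  Only a cluster A that is still uncovered can change its contribution to Htilde, and it does so
  exactly when the sampled point x lands in A. Under D^2 sampling this happens with probability
  proportional to cost(x,C), and the cost of A after adding x averages to at most 5 OPT_1(A):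
  the triangle inequality bounds cost(x,C) through cost(A,C) and the distances from x to A
  (Minkowski), the parallel axis theorem writes the latter through the centroid of A, and
  cost(A, C \<union> {x}) is bounded by the smaller of cost(A,C) and cost(A,{x}). Hence Htilde is a
  supermartingale. The uniformly chosen first center costs at most 2 OPT_1(A) in expectation,
  so E[Htilde_t] \<le> 5 \<Sigma> OPT_1(P_i) \<le> 5 OPT_k(X), and Htilde_t dominates the cost of the
  covered clusters.
\<close>

lemma cost_attained:
  assumes "finite C" "C \<noteq> {}"
  obtains y where "y \<in> C" "cost x C = (norm (x - y))\<^sup>2"
proof -
  have "finite ((\<lambda>c. (norm (x - c))\<^sup>2) ` C)" "(\<lambda>c. (norm (x - c))\<^sup>2) ` C \<noteq> {}"
    using assms by auto
  from Min_in[OF this] show ?thesis using that unfolding cost_def by auto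
qed

lemma cost_le: "finite C \<Longrightarrow> y \<in> C \<Longrightarrow> cost x C \<le> (norm (x - y))\<^sup>2"
  unfolding cost_def by (rule Min_le) auto

lemma cost_nonneg: "finite C \<Longrightarrow> C \<noteq> {} \<Longrightarrow> 0 \<le> cost x C"
  by (metis cost_attained zero_le_power2)

lemma cost_insert:
  "finite C \<Longrightarrow> C \<noteq> {} \<Longrightarrow> cost x (insert z C) = min ((norm (x - z))\<^sup>2) (cost x C)"
  unfolding cost_def by (simp add: Min_insert)

lemma cost_antimono: "finite C' \<Longrightarrow> C \<subseteq> C' \<Longrightarrow> C \<noteq> {} \<Longrightarrow> cost x C' \<le> cost x C"
  unfolding cost_def by (rule Min_antimono) auto

lemma cost_set_antimono:
  "finite C' \<Longrightarrow> C \<subseteq> C' \<Longrightarrow> C \<noteq> {} \<Longrightarrow> cost_set A C' \<le> cost_set A C"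
  unfolding cost_set_def by (intro sum_mono cost_antimono)

lemma cost_set_nonneg: "finite C \<Longrightarrow> C \<noteq> {} \<Longrightarrow> 0 \<le> cost_set A C"
  unfolding cost_set_def by (intro sum_nonneg cost_nonneg)

lemma cost_set_mono:
  "finite B \<Longrightarrow> A \<subseteq> B \<Longrightarrow> finite C \<Longrightarrow> C \<noteq> {} \<Longrightarrow> cost_set A C \<le> cost_set B C"
  unfolding cost_set_def by (intro sum_mono2 cost_nonneg)

lemma cost_set_singleton: "cost_set A {z} = (\<Sum>x\<in>A. (norm (x - z))\<^sup>2)"
  unfolding cost_set_def cost_def by simp

lemma sqrt_cost_le:
  assumes "finite C" "C \<noteq> {}"
  shows "sqrt (cost c C) \<le> sqrt (cost x C) + norm (x - c)"
proof -
  obtain y where y: "y \<in> C" "cost x C = (norm (x - y))\<^sup>2"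
    using cost_attained[OF assms] .
  have "cost c C \<le> (norm (c - y))\<^sup>2"
    by (rule cost_le[OF assms(1) y(1)])
  also have "\<dots> \<le> (norm (x - c) + norm (x - y))\<^sup>2"
    using norm_triangle_ineq4[of "x - y" "x - c"] by (intro power_mono) (simp_all add: algebra_simps)
  finally have "sqrt (cost c C) \<le> norm (x - c) + norm (x - y)"
    using real_sqrt_le_mono by fastforce
  then show ?thesis using y by simp
qed

definition centroid :: "'a::euclidean_space set \<Rightarrow> 'a" where
  "centroid A = inverse (real (card A)) *\<^sub>R (\<Sum>x\<in>A. x)"

lemma sum_diff_centroid:
  assumes "finite A" "A \<noteq> {}"
  shows "(\<Sum>x\<in>A. x - centroid A) = 0"
proof -
  have "real (card A) *\<^sub>R centroid A = (\<Sum>x\<in>A. x)"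
    using assms by (simp add: centroid_def card_gt_0_iff)
  then show ?thesis by (simp add: sum_subtractf sum_constant_scaleR)
qed

lemma sum_sq_dist_centroid:
  assumes "finite A" "A \<noteq> {}"
  shows "(\<Sum>x\<in>A. (norm (x - c))\<^sup>2)
       = (\<Sum>x\<in>A. (norm (x - centroid A))\<^sup>2) + real (card A) * (norm (c - centroid A))\<^sup>2"
proof -
  let ?m = "centroid A"
  have "(norm (x - c))\<^sup>2 = (norm (x - ?m))\<^sup>2 + 2 * ((x - ?m) \<bullet> (?m - c)) + (norm (c - ?m))\<^sup>2"
    for x
  proof -
    have "x - c = (x - ?m) + (?m - c)" by simp
    then show ?thesis
      by (simp only: power2_norm_eq_inner inner_add_left inner_add_right inner_commute
          norm_minus_commute[of c ?m])
  qed
  then have "(\<Sum>x\<in>A. (norm (x - c))\<^sup>2) = (\<Sum>x\<in>A. (norm (x - ?m))\<^sup>2)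
      + 2 * ((\<Sum>x\<in>A. x - ?m) \<bullet> (?m - c)) + real (card A) * (norm (c - ?m))\<^sup>2"
    by (simp add: sum.distrib sum_distrib_left inner_sum_left)
  then show ?thesis by (simp add: sum_diff_centroid[OF assms])
qed

lemma OPT1_greatest:
  assumes "\<And>z. r \<le> cost_set A {z}"
  shows "r \<le> OPT 1 A"
  unfolding OPT_def
proof (rule cINF_greatest)
  show "{C. finite C \<and> card C = 1} \<noteq> {}" by (auto intro!: exI[of _ "{0}"])
  fix C :: "'a set" assume "C \<in> {C. finite C \<and> card C = 1}"
  then show "r \<le> cost_set A C" using assms by (auto simp: card_1_singleton_iff)
qed

lemma OPT1_nonneg: "0 \<le> OPT 1 A"
  by (rule OPT1_greatest) (simp add: cost_set_singleton sum_nonneg)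

lemma OPT1_le: "OPT 1 A \<le> cost_set A {z}"
  unfolding OPT_def
proof (rule cINF_lower)
  show "bdd_below (cost_set A ` {C. finite C \<and> card C = 1})"
    by (rule bdd_belowI[of _ 0]) (auto simp: card_1_singleton_iff cost_set_singleton sum_nonneg)
qed simp

lemma sum_sq_dist_centroid_le_OPT1:
  assumes "finite A"
  shows "(\<Sum>x\<in>A. (norm (x - centroid A))\<^sup>2) \<le> OPT 1 A"
proof (cases "A = {}")
  case True
  then show ?thesis using OPT1_nonneg[of A] by simp
next
  case False
  show ?thesis
  proof (rule OPT1_greatest)
    fix z
    show "(\<Sum>x\<in>A. (norm (x - centroid A))\<^sup>2) \<le> cost_set A {z}"
      unfolding cost_set_singleton sum_sq_dist_centroid[OF assms False, of z] by simp
  qed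
qed

lemma sum_cost_set_singleton_le:
  assumes "finite A"
  shows "(\<Sum>x\<in>A. cost_set A {x}) \<le> 2 * real (card A) * OPT 1 A"
proof (cases "A = {}")
  case False
  let ?R = "\<Sum>y\<in>A. (norm (y - centroid A))\<^sup>2"
  have "(\<Sum>x\<in>A. cost_set A {x}) = (\<Sum>x\<in>A. ?R + real (card A) * (norm (x - centroid A))\<^sup>2)"
    unfolding cost_set_singleton by (intro sum.cong refl sum_sq_dist_centroid[OF assms False])
  also have "\<dots> = 2 * real (card A) * ?R"
    by (simp add: sum.distrib flip: sum_distrib_left)
  finally show ?thesis
    using sum_sq_dist_centroid_le_OPT1[OF assms] by (simp add: mult_left_mono)
qed simp

lemma card_mult_cost_le:
  assumes C: "finite C" "C \<noteq> {}"
  shows "real (card A) * cost c C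
       \<le> (sqrt (cost_set A C) + sqrt (\<Sum>x\<in>A. (norm (x - c))\<^sup>2))\<^sup>2"
proof -
  have "sqrt (real (card A) * cost c C) = L2_set (\<lambda>_. sqrt (cost c C)) A"
    using cost_nonneg[OF C] by (simp add: L2_set_constant real_sqrt_mult)
  also have "\<dots> \<le> L2_set (\<lambda>x. sqrt (cost x C) + norm (x - c)) A"
    using cost_nonneg[OF C] by (intro L2_set_mono sqrt_cost_le[OF C]) simp
  also have "\<dots> \<le> L2_set (\<lambda>x. sqrt (cost x C)) A + L2_set (\<lambda>x. norm (x - c)) A"
    by (rule L2_set_triangle_ineq)
  also have "\<dots> = sqrt (cost_set A C) + sqrt (\<Sum>x\<in>A. (norm (x - c))\<^sup>2)"
    using cost_nonneg[OF C] by (simp add: L2_set_def cost_set_def)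
  finally have "(sqrt (real (card A) * cost c C))\<^sup>2
      \<le> (sqrt (cost_set A C) + sqrt (\<Sum>x\<in>A. (norm (x - c))\<^sup>2))\<^sup>2"
    using cost_nonneg[OF C, of c] by (intro power_mono) simp_all
  then show ?thesis using cost_nonneg[OF C, of c] by simp
qed

lemma sqrt_add_sq_le_4_max:
  assumes "0 \<le> a" "0 \<le> b"
  shows "(sqrt a + sqrt b)\<^sup>2 \<le> 4 * max a b"
proof -
  have "sqrt a + sqrt b \<le> 2 * sqrt (max a b)"
    using real_sqrt_le_mono[of a "max a b"] real_sqrt_le_mono[of b "max a b"] by linarith
  then have "(sqrt a + sqrt b)\<^sup>2 \<le> (2 * sqrt (max a b))\<^sup>2"
    using assms by (intro power_mono) auto
  also have "(2 * sqrt (max a b))\<^sup>2 = 4 * max a b"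
    using assms by (simp add: power_mult_distrib)
  finally show ?thesis .
qed

lemma mult_min_le_of_sqrt_bound:
  fixes n D S R r :: real
  assumes n: "n > 0" and nonneg: "D \<ge> 0" "S \<ge> 0" "R \<ge> 0" "r \<ge> 0"
    and bound: "n * D \<le> (sqrt S + sqrt (R + n * r))\<^sup>2"
  shows "D * min S (R + n * r) \<le> R * D + 4 * S * r"
proof -
  define G where "G = R + n * r"
  have nD: "n * D \<le> 4 * max S G"
    using bound sqrt_add_sq_le_4_max[of S G] nonneg n by (simp add: G_def)
  consider "G \<le> S" | "S \<le> R" | "R < S" "S < G" by linarith
  then show ?thesis
  proof cases
    case 1
    then have "(n * D) * r \<le> (4 * S) * r" using nD nonneg by (intro mult_right_mono) auto
    then show ?thesis using 1 by (simp add: G_def algebra_simps)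
  next
    case 2
    have "D * min S (R + n * r) \<le> R * D"
      using 2 nonneg mult_left_mono[of "min S (R + n * r)" R D] by (simp add: mult.commute)
    moreover have "0 \<le> 4 * S * r" using nonneg by simp
    ultimately show ?thesis by linarith
  next
    case 3
    have "n * (D * (S - R)) \<le> 4 * G * (S - R)" using nD 3 by (simp add: mult_right_mono)
    also have "\<dots> \<le> n * (4 * S * r)"
      using 3 nonneg mult_left_mono[of S G R] by (simp add: G_def algebra_simps)
    finally have "D * (S - R) \<le> 4 * S * r" using n by simp
    then show ?thesis using 3 by (simp add: G_def[symmetric] algebra_simps)
  qed
qed

lemma sum_cost_mult_cost_set_insert_le:
  assumes A: "finite A" and C: "finite C" "C \<noteq> {}"
  shows "(\<Sum>c\<in>A. cost c C * cost_set A (insert c C)) \<le> 5 * OPT 1 A * cost_set A C"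
proof (cases "A = {}")
  case False
  define n where "n = real (card A)"
  define S where "S = cost_set A C"
  define m where "m = centroid A"
  define R where "R = (\<Sum>x\<in>A. (norm (x - m))\<^sup>2)"
  have n: "n > 0" using A False by (simp add: n_def card_gt_0_iff)
  have S: "S \<ge> 0" using cost_set_nonneg[OF C] by (simp add: S_def)
  have R: "R \<ge> 0" by (simp add: R_def sum_nonneg)
  have parallel_axis: "(\<Sum>x\<in>A. (norm (x - c))\<^sup>2) = R + n * (norm (c - m))\<^sup>2" for c
    unfolding R_def n_def m_def by (rule sum_sq_dist_centroid[OF A False])
  have "cost c C * cost_set A (insert c C) \<le> R * cost c C + 4 * S * (norm (c - m))\<^sup>2" for c
  proof -
    \<comment> \<open>Keeping the minimum of both bounds is what improves the constant 8 of
      Arthur and Vassilvitskii to 5.\<close>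
    have "cost_set A (insert c C) \<le> S" "cost_set A (insert c C) \<le> R + n * (norm (c - m))\<^sup>2"
      unfolding S_def cost_set_def parallel_axis[symmetric] using C
      by (intro sum_mono; simp add: cost_insert)+
    then have "cost c C * cost_set A (insert c C) \<le> cost c C * min S (R + n * (norm (c - m))\<^sup>2)"
      using cost_nonneg[OF C] by (intro mult_left_mono) auto
    also have "\<dots> \<le> R * cost c C + 4 * S * (norm (c - m))\<^sup>2"
      using card_mult_cost_le[OF C, of A c] cost_nonneg[OF C, of c]
      by (intro mult_min_le_of_sqrt_bound[OF n _ S R]) (simp_all add: n_def S_def parallel_axis)
    finally show ?thesis .
  qed
  then have "(\<Sum>c\<in>A. cost c C * cost_set A (insert c C))
      \<le> (\<Sum>c\<in>A. R * cost c C + 4 * S * (norm (c - m))\<^sup>2)"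
    by (rule sum_mono)
  also have "\<dots> = 5 * R * S"
    by (simp add: sum.distrib S_def R_def cost_set_def norm_minus_commute flip: sum_distrib_left)
  also have "\<dots> \<le> 5 * OPT 1 A * S"
    using sum_sq_dist_centroid_le_OPT1[OF A] S by (simp add: R_def m_def mult_right_mono)
  finally show ?thesis by (simp add: S_def)
qed (simp add: cost_set_def)

lemma pmf_d2_sample:
  assumes X: "finite X" and C: "finite C" "C \<noteq> {}" and S: "cost_set X C \<noteq> 0"
  shows "pmf (d2_sample X C) x = (if x \<in> X then cost x C / cost_set X C else 0)"
proof -
  define f where "f = (\<lambda>x. if x \<in> X then cost x C / cost_set X C else 0)"
  have nonneg: "0 \<le> f x" for x
    using cost_nonneg[OF C] cost_set_nonneg[OF C, of X] by (simp add: f_def)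
  have "(\<integral>\<^sup>+x. ennreal (f x) \<partial>count_space UNIV) = (\<Sum>x\<in>X. ennreal (f x))"
    by (rule nn_integral_count_space'[OF X]) (auto simp: f_def)
  also have "\<dots> = ennreal (\<Sum>x\<in>X. f x)"
    using nonneg by simp
  also have "(\<Sum>x\<in>X. f x) = 1"
    using S by (simp add: f_def cost_set_def flip: sum_divide_distrib)
  finally have "pmf (embed_pmf f) x = f x"
    by (intro pmf_embed_pmf nonneg) simp
  then show ?thesis using S by (simp add: d2_sample_def f_def)
qed

lemma set_pmf_d2_sample:
  assumes "finite X" "X \<noteq> {}" "finite C" "C \<noteq> {}"
  shows "set_pmf (d2_sample X C) \<subseteq> X"
proof (cases "cost_set X C = 0")
  case True
  then show ?thesis using assms by (simp add: d2_sample_def)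
next
  case False
  then show ?thesis using pmf_d2_sample[OF assms(1,3,4) False] by (auto simp: set_pmf_iff split: if_splits)
qed

lemma finite_set_pmf_d2_sample:
  assumes "finite X" "X \<noteq> {}" "finite C" "C \<noteq> {}"
  shows "finite (set_pmf (d2_sample X C))"
  using finite_subset[OF set_pmf_d2_sample[OF assms] assms(1)] .

lemma expectation_mono_finite_pmf:
  fixes f g :: "'b \<Rightarrow> real"
  assumes "finite (set_pmf p)" "\<And>x. x \<in> set_pmf p \<Longrightarrow> f x \<le> g x"
  shows "measure_pmf.expectation p f \<le> measure_pmf.expectation p g"
  using assms by (intro integral_mono_AE integrable_measure_pmf_finite AE_pmfI)

lemma expectation_bind_pmf_le:
  fixes g :: "'b \<Rightarrow> real"
  assumes "finite (set_pmf p)" "\<And>x. x \<in> set_pmf p \<Longrightarrow> finite (set_pmf (f x))"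
    and "\<And>x. x \<in> set_pmf p \<Longrightarrow> measure_pmf.expectation (f x) g \<le> h x"
  shows "measure_pmf.expectation (bind_pmf p f) g \<le> measure_pmf.expectation p h"
proof -
  have "measure_pmf.expectation (bind_pmf p f) g
      = (\<Sum>x\<in>set_pmf p. pmf p x * measure_pmf.expectation (f x) g)"
    using assms by (subst pmf_expectation_bind[of "set_pmf p"]) auto
  also have "\<dots> \<le> (\<Sum>x\<in>set_pmf p. pmf p x * h x)"
    using assms(3) by (intro sum_mono mult_left_mono) auto
  also have "\<dots> = measure_pmf.expectation p h"
    using assms(1) by (subst integral_measure_pmf_real[of "set_pmf p"]) (auto simp: mult.commute)
  finally show ?thesis .
qed

lemma expectation_if_mem_le:
  fixes F :: "'b \<Rightarrow> real"
  assumes B: "finite B" "set_pmf p \<subseteq> B" and AB: "A \<subseteq> B"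
    and bound: "(\<Sum>x\<in>A. pmf p x * F x) \<le> c * (\<Sum>x\<in>A. pmf p x)"
  shows "measure_pmf.expectation p (\<lambda>x. if x \<in> A then F x else c) \<le> c"
proof -
  have "measure_pmf.expectation p (\<lambda>x. if x \<in> A then F x else c)
      = (\<Sum>x\<in>B. c * pmf p x + (if x \<in> A then pmf p x * (F x - c) else 0))"
    using B by (subst integral_measure_pmf_real[OF B(1)]) (auto intro: sum.cong simp: algebra_simps)
  also have "\<dots> = c + (\<Sum>x\<in>A. pmf p x * (F x - c))"
    using B AB by (simp add: sum.distrib sum_pmf_eq_1 sum.If_cases Int_absorb1
        flip: sum_distrib_left)
  also have "\<dots> \<le> c"
    using bound by (simp add: algebra_simps sum_subtractf sum_distrib_left)
  finally show ?thesis .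
qed

lemma expectation_d2_sample_cluster_le:
  assumes X: "finite X" "X \<noteq> {}" and AX: "A \<subseteq> X" and C: "finite C" "C \<noteq> {}"
  shows "measure_pmf.expectation (d2_sample X C)
           (\<lambda>x. if x \<in> A then cost_set A (insert x C) else 5 * OPT 1 A) \<le> 5 * OPT 1 A"
proof (rule expectation_if_mem_le[OF X(1) set_pmf_d2_sample[OF X C] AX])
  have A: "finite A" using AX X(1) by (rule finite_subset)
  let ?p = "pmf (d2_sample X C)"
  have RHS: "0 \<le> 5 * OPT 1 A * (\<Sum>x\<in>A. ?p x)"
    using OPT1_nonneg[of A] by (simp add: sum_nonneg)
  show "(\<Sum>x\<in>A. ?p x * cost_set A (insert x C)) \<le> 5 * OPT 1 A * (\<Sum>x\<in>A. ?p x)"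
  proof (cases "cost_set X C = 0")
    case True
    \<comment> \<open>Here d2_sample falls back to uniform sampling, but every point of X is a center.\<close>
    have "cost_set A (insert x C) \<le> 0" for x
      using cost_set_antimono[OF _ subset_insertI C(2), of x A] cost_set_mono[OF X(1) AX C] True C
      by simp
    then have "(\<Sum>x\<in>A. ?p x * cost_set A (insert x C)) \<le> 0"
      by (intro sum_nonpos mult_nonneg_nonpos) auto
    then show ?thesis using RHS by linarith
  next
    case False
    have p: "?p x = cost x C / cost_set X C" if "x \<in> A" for x
      using pmf_d2_sample[OF X(1) C False] that AX by auto
    have "(\<Sum>x\<in>A. ?p x * cost_set A (insert x C))
        = (\<Sum>x\<in>A. cost x C * cost_set A (insert x C)) / cost_set X C"
      by (simp add: p sum_divide_distrib)
    also have "\<dots> \<le> 5 * OPT 1 A * cost_set A C / cost_set X C"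
      using sum_cost_mult_cost_set_insert_le[OF A C] cost_set_nonneg[OF C, of X]
      by (rule divide_right_mono)
    also have "\<dots> = 5 * OPT 1 A * (\<Sum>x\<in>A. ?p x)"
      by (simp add: p cost_set_def[of A] sum_divide_distrib[symmetric])
    finally show ?thesis .
  qed
qed

lemma expectation_uniform_cluster_le:
  assumes X: "finite X" "X \<noteq> {}" and AX: "A \<subseteq> X"
  shows "measure_pmf.expectation (pmf_of_set X)
           (\<lambda>x. if x \<in> A then cost_set A {x} else 5 * OPT 1 A) \<le> 5 * OPT 1 A"
proof (rule expectation_if_mem_le[OF X(1) _ AX])
  have A: "finite A" using AX X(1) by (rule finite_subset)
  have "(\<Sum>x\<in>A. cost_set A {x}) \<le> 5 * OPT 1 A * real (card A)"
    using sum_cost_set_singleton_le[OF A] mult_nonneg_nonneg[OF OPT1_nonneg[of A], of "card A"]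
    by (simp add: algebra_simps)
  then show "(\<Sum>x\<in>A. pmf (pmf_of_set X) x * cost_set A {x})
      \<le> 5 * OPT 1 A * (\<Sum>x\<in>A. pmf (pmf_of_set X) x)"
    using X AX by (auto simp: indicator_def subset_iff divide_right_mono
        simp flip: sum_divide_distrib)
qed (use X in simp)

lemma take_Least_cover_append:
  assumes "A \<inter> set h \<noteq> {}"
  shows "take (LEAST j. A \<inter> set (take j (h @ ys)) \<noteq> {}) (h @ ys)
       = take (LEAST j. A \<inter> set (take j h) \<noteq> {}) h"
proof -
  let ?P = "\<lambda>j. A \<inter> set (take j h) \<noteq> {}"
  define L where "L = (LEAST j. ?P j)"
  have L: "?P L" "L \<le> length h"
    using LeastI[of ?P "length h"] Least_le[of ?P "length h"] assms by (simp_all add: L_def)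
  have "(LEAST j. A \<inter> set (take j (h @ ys)) \<noteq> {}) = L"
  proof (rule Least_equality)
    show "A \<inter> set (take L (h @ ys)) \<noteq> {}" using L by simp
    fix j assume j: "A \<inter> set (take j (h @ ys)) \<noteq> {}"
    show "L \<le> j"
    proof (cases "j \<le> length h")
      case True
      then show ?thesis using j Least_le[of ?P j] by (simp add: L_def)
    qed (use L in simp)
  qed
  then show ?thesis using L by (simp add: L_def)
qed

lemma take_Least_cover_snoc:
  assumes "A \<inter> set h = {}" "x \<in> A"
  shows "take (LEAST j. A \<inter> set (take j (h @ [x])) \<noteq> {}) (h @ [x]) = h @ [x]"
proof -
  have "(LEAST j. A \<inter> set (take j (h @ [x])) \<noteq> {}) = Suc (length h)"
  proof (rule Least_equality)
    show "A \<inter> set (take (Suc (length h)) (h @ [x])) \<noteq> {}" using assms(2) by simp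
    fix j assume j: "A \<inter> set (take j (h @ [x])) \<noteq> {}"
    show "Suc (length h) \<le> j"
    proof (rule ccontr)
      assume "\<not> Suc (length h) \<le> j"
      then have "set (take j (h @ [x])) \<subseteq> set h" by (simp add: set_take_subset)
      then show False using j assms(1) by blast
    qed
  qed
  then show ?thesis by simp
qed

lemma Htilde_cluster_snoc:
  "Htilde_cluster (h @ [x]) A =
    (if A \<inter> set h = {} \<and> x \<in> A then cost_set A (insert x (set h)) else Htilde_cluster h A)"
proof -
  consider "A \<inter> set h \<noteq> {}" | "A \<inter> set h = {}" "x \<in> A" | "A \<inter> set h = {}" "x \<notin> A"
    by blast
  then show ?thesis
  proof cases
    case 1
    then show ?thesis unfolding Htilde_cluster_def take_Least_cover_append[OF 1] by auto
  next
    case 2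
    then show ?thesis unfolding Htilde_cluster_def take_Least_cover_snoc[OF 2] by auto
  next
    case 3
    then show ?thesis by (simp add: Htilde_cluster_def)
  qed
qed

lemma cost_set_le_Htilde_cluster:
  assumes "A \<inter> set h \<noteq> {}"
  shows "cost_set A (set h) \<le> Htilde_cluster h A"
proof -
  let ?P = "\<lambda>j. A \<inter> set (take j h) \<noteq> {}"
  have "?P (LEAST j. ?P j)" using LeastI[of ?P "length h"] assms by simp
  then have "set (take (LEAST j. ?P j) h) \<noteq> {}" by (metis inf_bot_right)
  then show ?thesis
    using assms cost_set_antimono[OF finite_set set_take_subset] by (simp add: Htilde_cluster_def)
qed

lemma Htilde_cluster_nonneg: "0 \<le> Htilde_cluster h A"
proof (cases "A \<inter> set h = {}")
  case False
  then have "set h \<noteq> {}" by (metis inf_bot_right)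
  then show ?thesis
    using cost_set_nonneg[of "set h" A] cost_set_le_Htilde_cluster[OF False] by simp
qed (use OPT1_nonneg[of A] in \<open>simp add: Htilde_cluster_def\<close>)

lemma expectation_d2_sample_Htilde_cluster_le:
  assumes X: "finite X" "X \<noteq> {}" and AX: "A \<subseteq> X" and h: "h \<noteq> []"
  shows "measure_pmf.expectation (d2_sample X (set h)) (\<lambda>x. Htilde_cluster (h @ [x]) A)
       \<le> Htilde_cluster h A"
proof (cases "A \<inter> set h = {}")
  case True
  then show ?thesis
    using expectation_d2_sample_cluster_le[OF X AX, of "set h"] h
    by (simp add: Htilde_cluster_snoc Htilde_cluster_def[of h] if_distrib cong: if_cong)
qed (simp add: Htilde_cluster_snoc)

lemma expectation_uniform_Htilde_cluster_le:
  assumes X: "finite X" "X \<noteq> {}" and AX: "A \<subseteq> X"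
  shows "measure_pmf.expectation (pmf_of_set X) (\<lambda>x. Htilde_cluster [x] A)
       \<le> Htilde_cluster [] A"
proof -
  have "Htilde_cluster [x] A = (if x \<in> A then cost_set A {x} else 5 * OPT 1 A)" for x
    using Htilde_cluster_snoc[of "[]" x A] by (simp add: Htilde_cluster_def[of "[]"])
  then show ?thesis
    using expectation_uniform_cluster_le[OF X AX] by (simp add: Htilde_cluster_def[of "[]"])
qed

lemma expectation_Htilde_snoc_le:
  assumes "finite (set_pmf q)"
    and "\<And>i. i < k \<Longrightarrow>
      measure_pmf.expectation q (\<lambda>x. Htilde_cluster (h @ [x]) (P i)) \<le> Htilde_cluster h (P i)"
  shows "measure_pmf.expectation q (\<lambda>x. Htilde k P (h @ [x])) \<le> Htilde k P h"
  unfolding Htilde_def using assms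
  by (subst Bochner_Integration.integral_sum) (auto intro: sum_mono integrable_measure_pmf_finite)

lemma expectation_kmpp_step_Htilde_le:
  assumes X: "finite X" "X \<noteq> {}" and P: "\<And>i. i < k \<Longrightarrow> P i \<subseteq> X" and h: "h \<noteq> []"
  shows "measure_pmf.expectation (kmpp_step X h) (Htilde k P) \<le> Htilde k P h"
  unfolding kmpp_step_def integral_map_pmf using h
  by (intro expectation_Htilde_snoc_le expectation_d2_sample_Htilde_cluster_le[OF X P h]
      finite_set_pmf_d2_sample[OF X]) auto

lemma set_pmf_kmpp:
  assumes X: "finite X" "X \<noteq> {}"
  shows "h \<in> set_pmf (kmpp X (Suc n)) \<Longrightarrow> set h \<subseteq> X \<and> length h = Suc n"
proof (induction n arbitrary: h)
  case 0
  then show ?case using X by auto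
next
  case (Suc n)
  then obtain h' x where h': "h' \<in> set_pmf (kmpp X (Suc n))"
    and x: "x \<in> set_pmf (d2_sample X (set h'))" and "h = h' @ [x]"
    by (auto simp: kmpp_step_def)
  moreover have "set h' \<subseteq> X" "length h' = Suc n" using Suc.IH[OF h'] by auto
  moreover have "x \<in> X" using set_pmf_d2_sample[OF X, of "set h'"] x calculation by force
  ultimately show ?case by simp
qed

lemma finite_set_pmf_kmpp:
  assumes X: "finite X" "X \<noteq> {}"
  shows "finite (set_pmf (kmpp X t))"
proof (cases t)
  case (Suc n)
  then have "set_pmf (kmpp X t) \<subseteq> {xs. set xs \<subseteq> X \<and> length xs = Suc n}"
    using set_pmf_kmpp[OF X] by blast
  then show ?thesis using finite_lists_length_eq[OF X(1)] finite_subset by blast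
qed simp

lemma expectation_kmpp_Htilde_le:
  assumes X: "finite X" "X \<noteq> {}" and P: "\<And>i. i < k \<Longrightarrow> P i \<subseteq> X"
  shows "measure_pmf.expectation (kmpp X (Suc n)) (Htilde k P) \<le> Htilde k P []"
proof (induction n)
  case 0
  show ?case
    using expectation_Htilde_snoc_le[of "pmf_of_set X" k "[]" P]
      expectation_uniform_Htilde_cluster_le[OF X P] X
    by simp
next
  case (Suc n)
  have "measure_pmf.expectation (bind_pmf (kmpp X (Suc n)) (kmpp_step X)) (Htilde k P)
      \<le> measure_pmf.expectation (kmpp X (Suc n)) (Htilde k P)"
  proof (rule expectation_bind_pmf_le[OF finite_set_pmf_kmpp[OF X]])
    fix h assume "h \<in> set_pmf (kmpp X (Suc n))"
    then have "h \<noteq> []" using set_pmf_kmpp[OF X, of h n] by auto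
    then show "finite (set_pmf (kmpp_step X h))"
      "measure_pmf.expectation (kmpp_step X h) (Htilde k P) \<le> Htilde k P h"
      using finite_set_pmf_d2_sample[OF X] expectation_kmpp_step_Htilde_le[OF X P]
      by (auto simp: kmpp_step_def)
  qed
  then show ?case using Suc.IH by simp
qed

lemma sum_OPT1_le_OPT:
  assumes X: "finite X" and "opt_clustering X k P"
  shows "(\<Sum>i<k. OPT 1 (P i)) \<le> OPT k X"
proof -
  from assms(2) obtain c where disj: "\<forall>i<k. \<forall>j<k. i \<noteq> j \<longrightarrow> P i \<inter> P j = {}"
    and cover: "(\<Union>i<k. P i) = X" and opt: "cost_set X (c ` {..<k}) = OPT k X"
    and nearest: "\<forall>i<k. \<forall>x\<in>P i. (norm (x - c i))\<^sup>2 = cost x (c ` {..<k})"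
    unfolding opt_clustering_def by blast
  have finite_P: "finite (P i)" if "i < k" for i
    using that cover finite_subset[OF _ X] by blast
  have "OPT 1 (P i) \<le> (\<Sum>x\<in>P i. cost x (c ` {..<k}))" if "i < k" for i
    using OPT1_le[of "P i" "c i"] nearest that by (simp add: cost_set_singleton)
  then have "(\<Sum>i<k. OPT 1 (P i)) \<le> (\<Sum>i<k. \<Sum>x\<in>P i. cost x (c ` {..<k}))"
    by (rule sum_mono) simp
  also have "\<dots> = cost_set X (c ` {..<k})"
    unfolding cost_set_def cover[symmetric] using finite_P disj
    by (intro sum.UNION_disjoint[symmetric]) auto
  finally show ?thesis using opt by simp
qed

lemma Htilde_nonneg: "0 \<le> Htilde k P h"
  unfolding Htilde_def by (intro sum_nonneg Htilde_cluster_nonneg)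

lemma Htilde_Nil_le_OPT:
  assumes "finite X" "opt_clustering X k P"
  shows "Htilde k P [] \<le> 5 * OPT k X"
  using sum_OPT1_le_OPT[OF assms] by (simp add: Htilde_def Htilde_cluster_def flip: sum_distrib_left)

lemma expectation_covered_cost_le_Htilde:
  assumes "finite (set_pmf p)"
  shows "(\<Sum>i<k. measure_pmf.expectation p
           (\<lambda>h. if P i \<inter> set h \<noteq> {} then cost_set (P i) (set h) else 0))
       \<le> measure_pmf.expectation p (Htilde k P)"
proof -
  have "(\<Sum>i<k. measure_pmf.expectation p
           (\<lambda>h. if P i \<inter> set h \<noteq> {} then cost_set (P i) (set h) else 0))
      = measure_pmf.expectation p
           (\<lambda>h. \<Sum>i<k. if P i \<inter> set h \<noteq> {} then cost_set (P i) (set h) else 0)"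
    by (rule Bochner_Integration.integral_sum[symmetric])
      (rule integrable_measure_pmf_finite[OF assms])
  also have "\<dots> \<le> measure_pmf.expectation p (Htilde k P)"
    unfolding Htilde_def
    by (intro expectation_mono_finite_pmf[OF assms] sum_mono)
      (simp add: cost_set_le_Htilde_cluster Htilde_cluster_nonneg)
  finally show ?thesis .
qed

theorem mainTheorem6:
  fixes X :: "'a::euclidean_space set" and k :: nat and P :: "nat \<Rightarrow> 'a set"
  assumes "finite X" and "X \<noteq> {}" and "k \<ge> 1" and "opt_clustering X k P"
  shows "(\<forall>t\<ge>1. \<forall>h\<in>set_pmf (kmpp X t).
            measure_pmf.expectation (kmpp_step X h) (Htilde k P) \<le> Htilde k P h)
       \<and> (\<forall>t. (\<Sum>i<k. measure_pmf.expectation (kmpp X t)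
                 (\<lambda>h. if P i \<inter> set h \<noteq> {} then cost_set (P i) (set h) else 0))
              \<le> 5 * OPT k X)"
proof -
  have PX: "P i \<subseteq> X" if "i < k" for i
    using assms(4) that unfolding opt_clustering_def by blast
  have "measure_pmf.expectation (kmpp_step X h) (Htilde k P) \<le> Htilde k P h"
    if "h \<in> set_pmf (kmpp X (Suc n))" for h n
  proof (rule expectation_kmpp_step_Htilde_le[OF assms(1,2) PX])
    show "h \<noteq> []" using set_pmf_kmpp[OF assms(1,2) that] by auto
  qed
  moreover have "(\<Sum>i<k. measure_pmf.expectation (kmpp X t)
          (\<lambda>h. if P i \<inter> set h \<noteq> {} then cost_set (P i) (set h) else 0)) \<le> 5 * OPT k X" for t
  proof (cases t)
    case (Suc n)
    have "(\<Sum>i<k. measure_pmf.expectation (kmpp X t)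
          (\<lambda>h. if P i \<inter> set h \<noteq> {} then cost_set (P i) (set h) else 0))
        \<le> measure_pmf.expectation (kmpp X t) (Htilde k P)"
      by (rule expectation_covered_cost_le_Htilde[OF finite_set_pmf_kmpp[OF assms(1,2)]])
    also have "\<dots> \<le> Htilde k P []"
      unfolding Suc by (rule expectation_kmpp_Htilde_le[OF assms(1,2) PX])
    finally show ?thesis using Htilde_Nil_le_OPT[OF assms(1,4)] by simp
  qed (use Htilde_nonneg[of k P "[]"] Htilde_Nil_le_OPT[OF assms(1,4)] in simp)
  ultimately show ?thesis by (auto dest!: Suc_le_D)
qed

end
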